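(* Let $\mathcal{I}$ and $\mathcal{I}'$ be two ideals on a set $X$ and let $\mathcal{J},\mathcal{J}'\subseteq 2^X$. Then the following properties hold: (a) $\mathcal{I}\subseteq(\mathcal{I}:\mathcal{J})$; (b) $\mathcal{J}\subseteq\mathcal{I}$ if and only if $(\mathcal{I}:\mathcal{J})=2^X$; (c) if $\mathcal{J}\subseteq\mathcal{J}'$, then $(\mathcal{I}:\mathcal{J}')\subseteq(\mathcal{I}:\mathcal{J})$; (d) if $X\in\mathcal{J}$, then $(\mathcal{I}:\mathcal{J})=\mathcal{I}$; (e) $(\mathcal{I}\cap\mathcal{I}':\mathcal{J})=(\mathcal{I}:\mathcal{J})\cap(\mathcal{I}':\mathcal{J})$.
   Context: An ideal on a set $X$ is a non-empty family $\mathcal{I}\subseteq 2^X$ ($2^X$ is the power set of $X$) such that (i) $A\in\mathcal{I}$ and $B\subseteq A$ imply $B\in\mathcal{I}$, and (ii) $A,B\in\mathcal{I}$ imply $A\cup B\in\mathcal{I}$. For an ideal $\mathcal{I}$ on $X$ and an arbitrary family $\mathcal{J}\subseteq 2^X$, the ideal quotient is $(\mathcal{I}:\mathcal{J})=\{A\subseteq X\mid (\forall J\in\mathcal{J})(A\cap J\in\mathcal{I})\}$. *)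

theory Defs
  imports Main
begin

text \<open>Ideals need not be proper: \<^term>\<open>Pow X\<close> is an ideal on \<^term>\<open>X\<close>.\<close>

definition ideal_on :: "'a set \<Rightarrow> 'a set set \<Rightarrow> bool" where
  "ideal_on X I \<longleftrightarrow>
     I \<subseteq> Pow X \<and> I \<noteq> {} \<and>
     (\<forall>A B. A \<in> I \<and> B \<subseteq> A \<longrightarrow> B \<in> I) \<and>
     (\<forall>A B. A \<in> I \<and> B \<in> I \<longrightarrow> A \<union> B \<in> I)"

definition ideal_quotient :: "'a set \<Rightarrow> 'a set set \<Rightarrow> 'a set set \<Rightarrow> 'a set set" where
  "ideal_quotient X I J = {A. A \<subseteq> X \<and> (\<forall>K\<in>J. A \<inter> K \<in> I)}"

end

theory Submission
  imports Defs
begin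

text \<open>
  Closure of an ideal under subsets gives the inclusion of \<^term>\<open>I\<close> in its quotients, since
  intersecting only shrinks a set. The other two properties that involve \<^term>\<open>I\<close> itself rest on
  one observation: inside \<^term>\<open>X\<close>, intersecting with \<^term>\<open>X\<close> changes nothing. Used for the set
  being tested, it shows that \<^term>\<open>X\<close> lies in the quotient exactly when \<^term>\<open>J \<subseteq> I\<close>, and the
  quotient, being closed under subsets, is all of \<^term>\<open>Pow X\<close> as soon as it contains \<^term>\<open>X\<close>.
  Used for the testing set, it shows that \<^term>\<open>X \<in> J\<close> forces every member of the quotient into
  \<^term>\<open>I\<close>. Antitonicity in \<^term>\<open>J\<close> and compatibility with intersections of ideals are pure
  logic: the condition defining the quotient is a universal quantification over \<^term>\<open>J\<close> of a
  membership in \<^term>\<open>I\<close>.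
\<close>

lemma ideal_on_downward: "ideal_on X I \<Longrightarrow> A \<in> I \<Longrightarrow> B \<subseteq> A \<Longrightarrow> B \<in> I"
  unfolding ideal_on_def by metis

lemma ideal_on_subset_Pow: "ideal_on X I \<Longrightarrow> I \<subseteq> Pow X"
  by (simp add: ideal_on_def)

lemma ideal_subset_quotient:
  assumes "ideal_on X I"
  shows "I \<subseteq> ideal_quotient X I J"
proof
  fix A assume "A \<in> I"
  then have "A \<subseteq> X" and "A \<inter> K \<in> I" for K
    using ideal_on_subset_Pow[OF assms] ideal_on_downward[OF assms, of A "A \<inter> K"] by auto
  then show "A \<in> ideal_quotient X I J"
    by (simp add: ideal_quotient_def)
qed

lemma ideal_quotient_eq_Pow_iff:
  assumes "ideal_on X I" and "J \<subseteq> Pow X"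
  shows "ideal_quotient X I J = Pow X \<longleftrightarrow> J \<subseteq> I"
proof
  assume "ideal_quotient X I J = Pow X"
  then have "X \<in> ideal_quotient X I J" by simp
  then have "X \<inter> K \<in> I" if "K \<in> J" for K
    using that unfolding ideal_quotient_def by blast
  moreover have "X \<inter> K = K" if "K \<in> J" for K
    using that assms(2) by blast
  ultimately show "J \<subseteq> I" by auto
next
  assume "J \<subseteq> I"
  then have "A \<inter> K \<in> I" if "K \<in> J" for A K
    using that ideal_on_downward[OF assms(1), of K "A \<inter> K"] by auto
  then show "ideal_quotient X I J = Pow X"
    by (auto simp: ideal_quotient_def)
qed

lemma ideal_quotient_antimono:
  "J \<subseteq> J' \<Longrightarrow> ideal_quotient X I J' \<subseteq> ideal_quotient X I J"
  unfolding ideal_quotient_def by blast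

lemma ideal_quotient_eq_ideal:
  assumes "ideal_on X I" and "X \<in> J"
  shows "ideal_quotient X I J = I"
proof
  show "ideal_quotient X I J \<subseteq> I"
  proof
    fix A assume "A \<in> ideal_quotient X I J"
    then have "A \<subseteq> X" and "A \<inter> X \<in> I"
      using assms(2) unfolding ideal_quotient_def by auto
    then show "A \<in> I" by (simp add: Int_absorb2)
  qed
  show "I \<subseteq> ideal_quotient X I J"
    by (rule ideal_subset_quotient[OF assms(1)])
qed

lemma ideal_quotient_Int:
  "ideal_quotient X (I \<inter> I') J = ideal_quotient X I J \<inter> ideal_quotient X I' J"
  unfolding ideal_quotient_def by blast

theorem theorem4p3:
  fixes X :: "'a set" and I I' J J' :: "'a set set"
  assumes "ideal_on X I" and "ideal_on X I'"
    and "J \<subseteq> Pow X" and "J' \<subseteq> Pow X"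
  shows "I \<subseteq> ideal_quotient X I J \<and>
    (J \<subseteq> I \<longleftrightarrow> ideal_quotient X I J = Pow X) \<and>
    (J \<subseteq> J' \<longrightarrow> ideal_quotient X I J' \<subseteq> ideal_quotient X I J) \<and>
    (X \<in> J \<longrightarrow> ideal_quotient X I J = I) \<and>
    ideal_quotient X (I \<inter> I') J = ideal_quotient X I J \<inter> ideal_quotient X I' J"
  using ideal_subset_quotient[OF assms(1), of J] ideal_quotient_eq_Pow_iff[OF assms(1,3)]
    ideal_quotient_antimono[of J J' X I] ideal_quotient_eq_ideal[OF assms(1), of J]
    ideal_quotient_Int[of X I I' J]
  by simp

end
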